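(* For every integer $n\ge 2$, $|B_n(132,213,321)|=n-1$.
   Context: A permutation $\sigma\in S_n$ is written as $\sigma(1)\cdots\sigma(n)$. An index $i\in[n-1]$ is an ascent if $\sigma(i)<\sigma(i+1)$ and a descent if $\sigma(i)>\sigma(i+1)$. A ballot permutation is a permutation such that every prefix $\sigma(1)\cdots\sigma(p)$ has at least as many ascents as descents. $\sigma$ contains a pattern $\pi\in S_k$ if some subsequence $\sigma(c_1)\cdots\sigma(c_k)$ with $c_1<\dots<c_k$ is order-isomorphic to $\pi$, and avoids $\pi$ otherwise. $B_n(\pi_1,\dots,\pi_m)$ denotes the set of ballot permutations of length $n$ avoiding all of $\pi_1,\dots,\pi_m$. *)

theory Defs
  imports "HOL-Combinatorics.Multiset_Permutations" "HOL-Library.Sublist"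
begin

text \<open>
  A permutation \<open>\<sigma> \<in> S\<^sub>n\<close> is represented by its one-line notation \<open>\<sigma>(1) \<cdots> \<sigma>(n)\<close>, that is, by an
  element of \<^term>\<open>permutations_of_set {1..n}\<close>. List positions start at 0, so position \<open>i\<close> of the
  list holds \<open>\<sigma>(i + 1)\<close>; this shift does not affect the numbers of ascents and descents.
\<close>

definition ascents :: "nat list \<Rightarrow> nat set" where
  "ascents w = {i. Suc i < length w \<and> w ! i < w ! Suc i}"

definition descents :: "nat list \<Rightarrow> nat set" where
  "descents w = {i. Suc i < length w \<and> w ! i > w ! Suc i}"

definition ballot :: "nat list \<Rightarrow> bool" where
  "ballot w \<longleftrightarrow> (\<forall>p. prefix p w \<longrightarrow> card (ascents p) \<ge> card (descents p))"

definition order_isomorphic :: "nat list \<Rightarrow> nat list \<Rightarrow> bool" where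
  "order_isomorphic u v \<longleftrightarrow>
     length u = length v \<and>
     (\<forall>i < length u. \<forall>j < length u. u ! i < u ! j \<longleftrightarrow> v ! i < v ! j)"

definition contains_pattern :: "nat list \<Rightarrow> nat list \<Rightarrow> bool" where
  "contains_pattern w \<pi> \<longleftrightarrow> (\<exists>u. subseq u w \<and> order_isomorphic u \<pi>)"

definition avoids_pattern :: "nat list \<Rightarrow> nat list \<Rightarrow> bool" where
  "avoids_pattern w \<pi> \<longleftrightarrow> \<not> contains_pattern w \<pi>"

definition ballot_perms_avoiding :: "nat \<Rightarrow> nat list set \<Rightarrow> nat list set" where
  "ballot_perms_avoiding n P =
     {\<sigma> \<in> permutations_of_set {1..n}. ballot \<sigma> \<and> (\<forall>\<pi>\<in>P. avoids_pattern \<sigma> \<pi>)}"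

end

theory Submission
  imports Defs
begin

text \<open>
  Let \<open>w\<close> avoid the three patterns. If \<open>w ! i < w ! Suc i\<close>, then a value strictly between the two
  would create a 213 or a 132 according to its position, so \<open>w ! Suc i = w ! i + 1\<close>. If
  \<open>w ! i > w ! Suc i\<close>, then the value \<open>n\<close> at another position would create a 321 or a 213, and the
  value 1 at another position a 132 or a 321, so \<open>w ! i = n\<close> and \<open>w ! Suc i = 1\<close>. Hence \<open>w\<close> is
  one of the \<open>n\<close> rotations of the identity, and exactly the rotation \<open>n 1 2 \<cdots>\<close> fails to be ballot.
\<close>

section \<open>Patterns of length three as conditions on positions\<close>

text \<open>Strictly increasing index lists make the positions of a subsequence explicit, so that an
  occurrence of a pattern becomes a statement about entries \<open>w ! i\<close>.\<close>

lemma subseq_iff_nth_indices: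
  "subseq u w \<longleftrightarrow>
     (\<exists>js. sorted_wrt (<) js \<and> set js \<subseteq> {..<length w} \<and> u = map ((!) w) js)"
  (is "_ \<longleftrightarrow> (\<exists>js. ?P js)")
proof
  assume "subseq u w"
  then show "\<exists>js. ?P js"
  proof (induction u w rule: list_emb.induct)
    case (list_emb_Nil ys)
    then show ?case by (intro exI[of _ "[]"]) simp
  next
    case (list_emb_Cons xs ys y)
    then obtain js where
      "sorted_wrt (<) js" "set js \<subseteq> {..<length ys}" "xs = map ((!) ys) js" by blast
    then show ?case
      by (intro exI[of _ "map Suc js"]) (auto simp: sorted_wrt_map)
  next
    case (list_emb_Cons2 x y xs ys)
    then obtain js where
      "sorted_wrt (<) js" "set js \<subseteq> {..<length ys}" "xs = map ((!) ys) js" by blast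
    with list_emb_Cons2 show ?case
      by (intro exI[of _ "0 # map Suc js"]) (auto simp: sorted_wrt_map)
  qed
next
  assume "\<exists>js. ?P js"
  then obtain js where js: "?P js" by blast
  \<comment> \<open>Both lists are strictly increasing and have the same elements. Written as a
    filter of all positions, \<open>js\<close> visibly selects a subsequence of
    \<open>w\<close>.\<close>
  have "filter (\<lambda>i. i \<in> set js) [0..<length w] = js"
    using js by (intro strict_sorted_equal) (auto intro: sorted_wrt_filter)
  then have "u = map ((!) w) (filter (\<lambda>i. i \<in> set js) [0..<length w])"
    using js by simp
  moreover have "subseq (map ((!) w) (filter (\<lambda>i. i \<in> set js) [0..<length w]))
                        (map ((!) w) [0..<length w])"
    by (intro subseq_map subseq_filter_left)
  ultimately show "subseq u w" by (simp add: map_nth)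
qed

lemma contains_pattern3_iff:
  "contains_pattern w [a, b, c] \<longleftrightarrow>
     (\<exists>i j k. i < j \<and> j < k \<and> k < length w \<and>
       order_isomorphic [w ! i, w ! j, w ! k] [a, b, c])"
proof
  assume "contains_pattern w [a, b, c]"
  then obtain js where js: "sorted_wrt (<) js" "set js \<subseteq> {..<length w}"
      and iso: "order_isomorphic (map ((!) w) js) [a, b, c]"
    unfolding contains_pattern_def subseq_iff_nth_indices by blast
  from iso have "length js = 3" by (simp add: order_isomorphic_def)
  then obtain i j k where "js = [i, j, k]"
    by (auto simp: length_Suc_conv numeral_3_eq_3)
  with js iso show "\<exists>i j k. i < j \<and> j < k \<and> k < length w \<and>
      order_isomorphic [w ! i, w ! j, w ! k] [a, b, c]"
    by (intro exI[of _ i] exI[of _ j] exI[of _ k]) simp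
next
  assume "\<exists>i j k. i < j \<and> j < k \<and> k < length w \<and>
      order_isomorphic [w ! i, w ! j, w ! k] [a, b, c]"
  then obtain i j k where ijk: "i < j" "j < k" "k < length w"
      and iso: "order_isomorphic [w ! i, w ! j, w ! k] [a, b, c]"
    by blast
  have "subseq [w ! i, w ! j, w ! k] w"
    unfolding subseq_iff_nth_indices using ijk by (intro exI[of _ "[i, j, k]"]) auto
  with iso show "contains_pattern w [a, b, c]"
    unfolding contains_pattern_def by blast
qed

lemma order_isomorphic3_iff:
  "order_isomorphic [x, y, z] [a, b, c] \<longleftrightarrow>
     (x < y \<longleftrightarrow> a < b) \<and> (y < x \<longleftrightarrow> b < a) \<and> (x < z \<longleftrightarrow> a < c) \<and>
     (z < x \<longleftrightarrow> c < a) \<and> (y < z \<longleftrightarrow> b < c) \<and> (z < y \<longleftrightarrow> c < b)"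
  by (auto simp: order_isomorphic_def less_Suc_eq numeral_3_eq_3)

lemma avoids_132_iff:
  "avoids_pattern w [1, 3, 2] \<longleftrightarrow>
     \<not> (\<exists>i j k. i < j \<and> j < k \<and> k < length w \<and> w ! i < w ! k \<and> w ! k < w ! j)"
proof -
  \<comment> \<open>The chain \<open>x < z\<close>, \<open>z < y\<close> settles all six comparisons
    by transitivity.\<close>
  have "order_isomorphic [x, y, z] [1, 3, 2] \<longleftrightarrow> x < z \<and> z < y" for x y z
    unfolding order_isomorphic3_iff by auto
  then show ?thesis
    unfolding avoids_pattern_def contains_pattern3_iff by simp
qed

lemma avoids_213_iff:
  "avoids_pattern w [2, 1, 3] \<longleftrightarrow>
     \<not> (\<exists>i j k. i < j \<and> j < k \<and> k < length w \<and> w ! j < w ! i \<and> w ! i < w ! k)"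
proof -
  have "order_isomorphic [x, y, z] [2, 1, 3] \<longleftrightarrow> y < x \<and> x < z" for x y z
    unfolding order_isomorphic3_iff by auto
  then show ?thesis
    unfolding avoids_pattern_def contains_pattern3_iff by simp
qed

lemma avoids_321_iff:
  "avoids_pattern w [3, 2, 1] \<longleftrightarrow>
     \<not> (\<exists>i j k. i < j \<and> j < k \<and> k < length w \<and> w ! k < w ! j \<and> w ! j < w ! i)"
proof -
  have "order_isomorphic [x, y, z] [3, 2, 1] \<longleftrightarrow> z < y \<and> y < x" for x y z
    unfolding order_isomorphic3_iff by auto
  then show ?thesis
    unfolding avoids_pattern_def contains_pattern3_iff by simp
qed

section \<open>Avoiding permutations as rotations of the identity\<close>

text \<open>The entry is \<open>(k + i) mod n + 1\<close>. Since \<open>k + i < 2 * n\<close>, the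
  remainder subtracts \<open>n\<close> at most once, and the case split leaves only linear
  arithmetic.\<close>

lemma nth_rotate_upt:
  assumes "k < n" "i < n"
  shows "rotate k [1..<Suc n] ! i = (if k + i < n then k + i + 1 else k + i + 1 - n)"
proof -
  have "rotate k [1..<Suc n] ! i = [1..<Suc n] ! ((k + i) mod n)"
    using assms nth_rotate[of i "[1..<Suc n]" k] by simp
  also have "\<dots> = (k + i) mod n + 1"
    using assms by (subst nth_upt) auto
  also have "\<dots> = (if k + i < n then k + i + 1 else k + i + 1 - n)"
    using assms by (auto simp: mod_if)
  finally show ?thesis .
qed

lemma avoiding_perm_cyclic_succ:
  assumes perm: "w \<in> permutations_of_set {1..n}"
    and a132: "avoids_pattern w [1, 3, 2]"
    and a213: "avoids_pattern w [2, 1, 3]"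
    and a321: "avoids_pattern w [3, 2, 1]"
    and i: "Suc i < n"
  shows "w ! Suc i = (if w ! i = n then 1 else w ! i + 1)"
proof -
  have set_w: "set w = {1..n}" and dist: "distinct w"
    using perm by (auto simp: permutations_of_set_def)
  have len: "length w = n"
    using set_w dist distinct_card by fastforce
  have pos: "\<exists>p<n. w ! p = v" if "1 \<le> v" "v \<le> n" for v
  proof -
    have "v \<in> set w" using that set_w by simp
    then show ?thesis using len by (auto simp: in_set_conv_nth)
  qed
  have bounds: "1 \<le> w ! j \<and> w ! j \<le> n" if "j < n" for j
    using that len set_w nth_mem[of j w] by auto
  have no132: "\<not> (w ! p < w ! r \<and> w ! r < w ! q)"
    and no213: "\<not> (w ! q < w ! p \<and> w ! p < w ! r)"
    and no321: "\<not> (w ! r < w ! q \<and> w ! q < w ! p)"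
    if "p < q" "q < r" "r < n" for p q r
    using that len a132 a213 a321 unfolding avoids_132_iff avoids_213_iff avoids_321_iff by blast+
  have "w ! i \<noteq> w ! Suc i"
    using dist i len by (simp add: nth_eq_iff_index_eq)
  then consider "w ! i < w ! Suc i" | "w ! i > w ! Suc i" by linarith
  then show ?thesis
  proof cases
    case 1
    have "w ! Suc i = w ! i + 1"
    proof (rule ccontr)
      assume "w ! Suc i \<noteq> w ! i + 1"
      with 1 have between: "w ! i < w ! i + 1" "w ! i + 1 < w ! Suc i" by auto
      then obtain p where p: "p < n" "w ! p = w ! i + 1"
        using pos[of "w ! i + 1"] bounds[OF i] by auto
      with between have "p \<noteq> i" "p \<noteq> Suc i" by auto
      then consider "p < i" | "Suc i < p" by linarith
      then show False
        \<comment> \<open>To the left of \<open>i\<close>, the intermediate value is the 2 of a 213;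
          to the right of \<open>Suc i\<close>, it is the 2 of a 132.\<close>
        using no213[of p i "Suc i"] no132[of i "Suc i" p] p i between by cases auto
    qed
    \<comment> \<open>From \<open>w ! i + 1 = w ! Suc i \<le> n\<close> it follows that
      \<open>w ! i \<noteq> n\<close>, which selects the second branch.\<close>
    then show ?thesis using bounds[OF i] by auto
  next
    case 2
    have "w ! i = n"
    proof (rule ccontr)
      assume "w ! i \<noteq> n"
      with bounds[of i] i have less: "w ! i < n" by auto
      then obtain p where p: "p < n" "w ! p = n" using pos[of n] by auto
      with less 2 have "p \<noteq> i" "p \<noteq> Suc i" by auto
      then consider "p < i" | "Suc i < p" by linarith
      then show False
        \<comment> \<open>The value \<open>n\<close> is the 3 of a 321 on the left and of a 213 on
          the right.\<close>
        using no321[of p i "Suc i"] no213[of i "Suc i" p] p i less 2 by cases auto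
    qed
    moreover have "w ! Suc i = 1"
    proof (rule ccontr)
      assume "w ! Suc i \<noteq> 1"
      with bounds[OF i] have less: "1 < w ! Suc i" by auto
      then obtain p where p: "p < n" "w ! p = 1" using pos[of 1] i by auto
      with less 2 have "p \<noteq> i" "p \<noteq> Suc i" by auto
      then consider "p < i" | "Suc i < p" by linarith
      then show False
        \<comment> \<open>The value 1 is the 1 of a 132 on the left and of a 321 on the
          right.\<close>
        using no132[of p i "Suc i"] no321[of i "Suc i" p] p i less 2 by cases auto
    qed
    ultimately show ?thesis by simp
  qed
qed

text \<open>The cyclic successor rule determines every entry from the first one. The rotation by
  \<open>w ! 0 - 1\<close> also starts with \<open>w ! 0\<close> and obeys the same rule, so
  induction on the position identifies the two.\<close>

lemma avoiding_perm_is_rotation: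
  assumes perm: "w \<in> permutations_of_set {1..n}"
    and "avoids_pattern w [1, 3, 2]" "avoids_pattern w [2, 1, 3]" "avoids_pattern w [3, 2, 1]"
    and n: "0 < n"
  shows "w = rotate (w ! 0 - 1) [1..<Suc n]" "1 \<le> w ! 0" "w ! 0 \<le> n"
proof -
  have set_w: "set w = {1..n}" and dist: "distinct w"
    using perm by (auto simp: permutations_of_set_def)
  have len: "length w = n"
    using set_w dist distinct_card by fastforce
  show bounds: "1 \<le> w ! 0" "w ! 0 \<le> n"
    using n len set_w nth_mem[of 0 w] by auto
  have nth: "w ! i = rotate (w ! 0 - 1) [1..<Suc n] ! i" if "i < n" for i
    using that
  proof (induction i)
    case 0
    then show ?case using nth_rotate_upt[of "w ! 0 - 1" n 0] bounds by simp
  next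
    case (Suc i)
    have "w ! Suc i = (if w ! i = n then 1 else w ! i + 1)"
      using avoiding_perm_cyclic_succ[OF assms(1-4) Suc.prems] .
    with Suc show ?case
      using nth_rotate_upt[of "w ! 0 - 1" n i] nth_rotate_upt[of "w ! 0 - 1" n "Suc i"] bounds
      by (auto split: if_splits)
  qed
  show "w = rotate (w ! 0 - 1) [1..<Suc n]"
  proof (rule nth_equalityI)
    show "length w = length (rotate (w ! 0 - 1) [1..<Suc n])" using len by simp
    show "w ! i = rotate (w ! 0 - 1) [1..<Suc n] ! i" if "i < length w" for i
      using that unfolding len by (rule nth)
  qed
qed

section \<open>The ballot condition and pattern avoidance for rotations\<close>

text \<open>An initial descent would give the prefix of length two one descent and no
  ascent.\<close>

lemma ballot_first_step_ascent:
  assumes "ballot w" "2 \<le> length w"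
  shows "w ! 0 \<le> w ! 1"
proof (rule ccontr)
  assume desc: "\<not> w ! 0 \<le> w ! 1"
  have "ascents (take 2 w) = {}" "descents (take 2 w) = {0}"
    using desc assms(2) by (auto simp: ascents_def descents_def less_Suc_eq numeral_2_eq_2)
  moreover have "card (descents (take 2 w)) \<le> card (ascents (take 2 w))"
    using assms(1) take_is_prefix unfolding ballot_def by blast
  ultimately show False by simp
qed

text \<open>The only possible descent is the step from \<open>n\<close> to 1. By
  \<open>k + 2 \<le> n\<close> it is not the first step, so any prefix reaching it already contains
  the ascent from \<open>k + 1\<close> to \<open>k + 2\<close>.\<close>

lemma rotation_ballot:
  assumes "k + 2 \<le> n"
  shows "ballot (rotate k [1..<Suc n])"
  unfolding ballot_def
proof (intro allI impI)
  fix p :: "nat list"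
  let ?w = "rotate k [1..<Suc n]"
  assume "prefix p ?w"
  then have nth: "p ! i = ?w ! i" if "i < length p" for i
    using that by (auto simp: prefix_def nth_append)
  have len: "length p \<le> n"
    using prefix_length_le[OF \<open>prefix p ?w\<close>] by (simp del: upt_Suc)
  have val: "p ! i = (if k + i < n then k + i + 1 else k + i + 1 - n)" if "i < length p" for i
    using nth[OF that] that len assms nth_rotate_upt[of k n i] by simp
  \<comment> \<open>Position \<open>n - k - 1\<close> of the rotation holds the value
    \<open>n\<close>.\<close>
  have sub: "descents p \<subseteq> {n - k - 1}"
    using val len assms by (auto simp: descents_def split: if_splits)
  show "card (descents p) \<le> card (ascents p)"
  proof (cases "descents p = {}")
    case False
    then obtain i where "i \<in> descents p" by blast
    with sub have "Suc (n - k - 1) < length p" by (auto simp: descents_def)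
    then have p: "0 < length p" "1 < length p" using assms by linarith+
    have "0 \<in> ascents p"
      using val[OF p(1)] val[OF p(2)] p assms by (simp add: ascents_def)
    moreover have "finite (ascents p)"
      by (rule finite_subset[of _ "{..<length p}"]) (auto simp: ascents_def)
    ultimately have "1 \<le> card (ascents p)"
      by (metis One_nat_def Suc_leI card_gt_0_iff empty_iff)
    moreover have "card (descents p) \<le> 1"
      using card_mono[OF _ sub] by simp
    ultimately show ?thesis by linarith
  qed simp
qed

text \<open>A rotation consists of the increasing blocks \<open>k + 1, ..., n\<close> and
  \<open>1, ..., k\<close>, the first lying entirely above the second. Three of its entries thus
  form a 123, 231 or 312, depending on how many lie in each block.\<close>

lemma rotation_avoids:
  assumes "k < n"
  shows "avoids_pattern (rotate k [1..<Suc n]) [1, 3, 2]"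
    "avoids_pattern (rotate k [1..<Suc n]) [2, 1, 3]"
    "avoids_pattern (rotate k [1..<Suc n]) [3, 2, 1]"
proof -
  let ?w = "rotate k [1..<Suc n]"
  have len: "length ?w = n" by simp
  note val = nth_rotate_upt[OF assms]
  have "\<not> (?w ! p < ?w ! r \<and> ?w ! r < ?w ! q)"
    and "\<not> (?w ! q < ?w ! p \<and> ?w ! p < ?w ! r)"
    and "\<not> (?w ! r < ?w ! q \<and> ?w ! q < ?w ! p)"
    if "p < q" "q < r" "r < n" for p q r
    using that assms val[of p] val[of q] val[of r] by (auto split: if_splits)
  then show "avoids_pattern ?w [1, 3, 2]" "avoids_pattern ?w [2, 1, 3]" "avoids_pattern ?w [3, 2, 1]"
    unfolding avoids_132_iff avoids_213_iff avoids_321_iff len by blast+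
qed

section \<open>Enumeration of the ballot rotations\<close>

lemma ballot_perms_avoiding_eq_rotations:
  assumes "2 \<le> n"
  shows "ballot_perms_avoiding n {[1, 3, 2], [2, 1, 3], [3, 2, 1]} =
    (\<lambda>k. rotate k [1..<Suc n]) ` {..<n - 1}"
proof (intro equalityI subsetI)
  fix w assume "w \<in> ballot_perms_avoiding n {[1, 3, 2], [2, 1, 3], [3, 2, 1]}"
  then have w: "w \<in> permutations_of_set {1..n}" "avoids_pattern w [1, 3, 2]"
      "avoids_pattern w [2, 1, 3]" "avoids_pattern w [3, 2, 1]" and "ballot w"
    by (auto simp: ballot_perms_avoiding_def)
  have n: "0 < n" using assms by simp
  note rot = avoiding_perm_is_rotation[OF w n]
  have "length w = n" by (subst rot(1)) simp
  then have "w ! 0 \<le> w ! 1"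
    using ballot_first_step_ascent \<open>ballot w\<close> assms by simp
  moreover have "w ! Suc 0 = (if w ! 0 = n then 1 else w ! 0 + 1)"
    using avoiding_perm_cyclic_succ[OF w] assms by simp
  \<comment> \<open>A first entry \<open>n\<close> would be followed by 1, which is smaller as
    \<open>n \<ge> 2\<close>. This rules out the rotation by \<open>n - 1\<close>.\<close>
  ultimately have "w ! 0 \<noteq> n" using assms by auto
  then have "w ! 0 - 1 < n - 1" using rot(2,3) by linarith
  then show "w \<in> (\<lambda>k. rotate k [1..<Suc n]) ` {..<n - 1}"
    using rot(1) by blast
next
  fix w assume "w \<in> (\<lambda>k. rotate k [1..<Suc n]) ` {..<n - 1}"
  then obtain k where k: "k < n - 1" and w: "w = rotate k [1..<Suc n]" by blast
  have "w \<in> permutations_of_set {1..n}"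
    unfolding w permutations_of_set_def by (auto simp del: upt_Suc)
  moreover have "ballot w" unfolding w using k by (intro rotation_ballot) simp
  ultimately show "w \<in> ballot_perms_avoiding n {[1, 3, 2], [2, 1, 3], [3, 2, 1]}"
    using rotation_avoids[of k n] k unfolding w ballot_perms_avoiding_def by auto
qed

theorem theorem4p6:
  fixes n :: nat
  assumes "n \<ge> 2"
  shows "card (ballot_perms_avoiding n {[1, 3, 2], [2, 1, 3], [3, 2, 1]}) = n - 1"
proof -
  have "inj_on (\<lambda>k. rotate k [1..<Suc n]) {..<n - 1}"
  proof (rule inj_onI)
    fix k l assume "k \<in> {..<n - 1}" "l \<in> {..<n - 1}"
      and "rotate k [1..<Suc n] = rotate l [1..<Suc n]"
    then show "k = l"
      \<comment> \<open>The first entry of the rotation by \<open>k\<close> is \<open>k + 1\<close>,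
        so it recovers \<open>k\<close>.\<close>
      using nth_rotate_upt[of k n 0] nth_rotate_upt[of l n 0] by (auto simp del: upt_Suc)
  qed
  then show ?thesis
    unfolding ballot_perms_avoiding_eq_rotations[OF assms] by (simp add: card_image)
qed

end
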